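(* Let $X$ be a Banach space and let $(x_k)$ be a bounded sequence in $X$. Then \[ \widetilde{\delta}(x_k)\leq 2\,\widehat{\operatorname{d}}(\operatorname{clust}_{X^{**}}(x_k), X). \] If, moreover, $X$ is $L$-embedded, then also \[ 2\,\widehat{\operatorname{d}}(\operatorname{clust}_{X^{**}}(x_k), X)\leq \delta_X(x_k) \qquad\text{and}\qquad 2\,\operatorname{d}(\operatorname{clust}_{X^{**}}(x_k),X)\leq \widetilde{\delta}(x_k). \]
   Context: Banach spaces are real. $X$ is identified with its canonical image in the bidual $X^{**}$. For a bounded sequence $(x_k)$ in $X$, $\operatorname{clust}_{X^{**}}(x_k)$ denotes the set of all weak$^*$ cluster points of $(x_k)$ in $X^{**}$, and $\delta_X(x_k)$ denotes the diameter (in the norm of $X^{**}$) of this set; equivalently $\delta_X(x_k)=\sup_{x^*\in B_{X^*}}\big(\limsup_k x^*(x_k)-\liminf_k x^*(x_k)\big)$. Further, $\widetilde{\delta}(x_k)=\inf\{\delta_X(x_{k_j}) : (x_{k_j}) \text{ a subsequence of } (x_k)\}$. For nonempty subsets $A,B$ of a Banach space, $\operatorname{d}(A,B)=\inf\{\|a-b\|: a\in A, b\in B\}$ and $\widehat{\operatorname{d}}(A,B)=\sup\{\operatorname{d}(a,B): a\in A\}$. A Banach space $X$ is $L$-embedded if there is a projection $P$ of $X^{**}$ onto $X$ such that $\|x^{**}\|=\|Px^{**}\|+\|x^{**}-Px^{**}\|$ for all $x^{**}\in X^{**}$. *)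

theory Defs
  imports "HOL-Analysis.Analysis"
begin

type_synonym 'a bidual = "('a \<Rightarrow>\<^sub>L real) \<Rightarrow>\<^sub>L real"

definition canon :: "'a::real_normed_vector \<Rightarrow> 'a bidual" where
  "canon x = Blinfun (\<lambda>f. blinfun_apply f x)"

text \<open>Weak* cluster points in X** of a sequence in X: every basic weak* neighbourhood
  (given by finitely many functionals and a radius) is visited infinitely often.\<close>
definition clust :: "(nat \<Rightarrow> 'a::real_normed_vector) \<Rightarrow> 'a bidual set" where
  "clust x = {z. \<forall>F e N. finite F \<longrightarrow> e > 0 \<longrightarrow>
      (\<exists>k\<ge>N. \<forall>f\<in>F. \<bar>blinfun_apply z f - blinfun_apply f (x k)\<bar> < e)}"

definition delta_X :: "(nat \<Rightarrow> 'a::real_normed_vector) \<Rightarrow> real" where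
  "delta_X x = diameter (clust x)"

definition delta_tilde :: "(nat \<Rightarrow> 'a::real_normed_vector) \<Rightarrow> real" where
  "delta_tilde x = (INF r\<in>{r::nat\<Rightarrow>nat. strict_mono r}. delta_X (x \<circ> r))"

definition set_dist :: "'b::metric_space set \<Rightarrow> 'b set \<Rightarrow> real" where
  "set_dist A B = (INF a\<in>A. infdist a B)"

definition set_dhat :: "'b::metric_space set \<Rightarrow> 'b set \<Rightarrow> real" where
  "set_dhat A B = (SUP a\<in>A. infdist a B)"

definition L_embedded :: "'a::real_normed_vector itself \<Rightarrow> bool" where
  "L_embedded _ = (\<exists>P :: 'a bidual \<Rightarrow> 'a bidual.
      linear P \<and> P ` UNIV = range (canon :: 'a \<Rightarrow> 'a bidual) \<and>
      (\<forall>z \<in> range (canon :: 'a \<Rightarrow> 'a bidual). P z = z) \<and>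
      (\<forall>z. norm z = norm (P z) + norm (z - P z)))"

end

theory Submission
  imports Defs
begin

text \<open>For the first inequality, if every subsequence has \<open>delta_X > d\<close>, a greedy choice yields a
  subsequence \<open>x (k j)\<close> and functionals \<open>f n\<close> in the dual ball with \<open>f n (x (k j)) \<ge> r + d\<close> for
  \<open>j < n\<close> and \<open>f n (x (k j)) \<le> r\<close> for \<open>j \<ge> n\<close>. Let \<open>z\<close> and \<open>g\<close> be weak* cluster points of
  \<open>x (k j)\<close> and of \<open>f n\<close>. Then \<open>z g \<ge> r + d\<close> and \<open>z (f n) \<le> r\<close>, while a \<open>y\<close> in the space with
  \<open>norm (z - y) \<le> e\<close> has \<open>g y\<close> among the cluster values of \<open>f n y\<close>, whence \<open>d \<le> 2 * e\<close>.

  For an L-projection \<open>P\<close> and a cluster point \<open>z\<close>, Goldstine's theorem for the dual space prescribes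
  the value of a norm-one functional approximately as \<open>\<plusminus> norm (z - P z)\<close> at \<open>z - P z\<close> without
  disturbing finitely many values already fixed on the space. Iterating gives one functional that
  takes values near both \<open>norm (z - P z)\<close> and \<open>- norm (z - P z)\<close> infinitely often along
  \<open>x k - P z\<close>.\<close>

section \<open>Norms of functionals, the canonical embedding and weak* cluster points\<close>

lemma norm_blinfun_less_witness:
  fixes z :: "'b::real_normed_vector \<Rightarrow>\<^sub>L real"
  assumes "0 \<le> d" "d < norm z"
  obtains f where "norm f \<le> 1" "d < z f"
proof -
  have "\<exists>f. norm f \<le> 1 \<and> d < z f"
  proof (rule ccontr)
    assume "\<not> ?thesis"
    then have le: "z f \<le> d" if "norm f \<le> 1" for f
      using that by force
    have "norm (z f) \<le> d * norm f" for f
    proof (cases "f = 0")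
      case False
      have "z (f /\<^sub>R norm f) \<le> d" "z (- (f /\<^sub>R norm f)) \<le> d"
        using False by (auto intro!: le)
      then have "\<bar>z f\<bar> / norm f \<le> d"
        by (auto simp: blinfun.scaleR_right blinfun.minus_right abs_if divide_inverse mult.commute)
      with False show ?thesis
        by (simp add: pos_divide_le_eq)
    qed (simp add: blinfun.zero_right)
    with assms show False
      using norm_blinfun_bound[of d z] by simp
  qed
  then show ?thesis
    using that by blast
qed

lemma blinfun_apply_le_norm:
  fixes z :: "'b::real_normed_vector \<Rightarrow>\<^sub>L real"
  assumes "norm f \<le> 1"
  shows "\<bar>z f\<bar> \<le> norm z"
  using norm_blinfun[of z f] mult_left_mono[OF assms norm_ge_zero[of z]] by simp

lemma blinfun_apply_canon [simp]: "blinfun_apply (canon x) f = f x"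
  unfolding canon_def by (subst bounded_linear_Blinfun_apply) (auto intro: blinfun.bounded_linear_left)

lemma norm_canon_le: "norm (canon x) \<le> norm x"
  by (rule norm_blinfun_bound) (auto, metis norm_blinfun real_norm_def mult.commute)

lemma canon_zero [simp]: "canon 0 = 0"
  by (rule blinfun_eqI) (simp add: blinfun.zero_right)

text \<open>Cluster points occur in two duals: those of \<open>canon (x k)\<close> in the bidual,
  which make up \<open>clust x\<close>, and those of sequences of functionals. One notion in the
  dual of an arbitrary normed space covers both.\<close>

definition weakstar_cluster :: "(nat \<Rightarrow> 'b::real_normed_vector \<Rightarrow>\<^sub>L real) \<Rightarrow> ('b \<Rightarrow>\<^sub>L real) \<Rightarrow> bool" where
  "weakstar_cluster h g \<longleftrightarrow> (\<forall>F e N. finite F \<longrightarrow> e > 0 \<longrightarrow> (\<exists>k\<ge>N. \<forall>f\<in>F. \<bar>g f - h k f\<bar> < e))"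

lemma clust_eq_weakstar_cluster: "clust x = {z. weakstar_cluster (\<lambda>k. canon (x k)) z}"
  by (simp add: clust_def weakstar_cluster_def)

lemma weakstar_clusterD:
  assumes "weakstar_cluster h g" "finite F" "e > 0"
  obtains k where "k \<ge> N" "\<And>f. f \<in> F \<Longrightarrow> \<bar>g f - h k f\<bar> < e"
  using assms unfolding weakstar_cluster_def by meson

lemma weakstar_cluster_le:
  assumes "weakstar_cluster h g" and le: "\<And>k. k \<ge> N \<Longrightarrow> h k f \<le> c"
  shows "g f \<le> c"
proof (rule field_le_epsilon)
  fix e :: real assume "e > 0"
  then obtain k where "k \<ge> N" "\<bar>g f - h k f\<bar> < e"
    using weakstar_clusterD[OF assms(1), of "{f}" e N] by auto
  with le[of k] show "g f \<le> c + e" by linarith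
qed

lemma weakstar_cluster_ge:
  assumes "weakstar_cluster h g" and ge: "\<And>k. k \<ge> N \<Longrightarrow> c \<le> h k f"
  shows "c \<le> g f"
  using weakstar_cluster_le[OF assms(1), of N "- f" "- c"] ge by (simp add: blinfun.minus_right)

lemma weakstar_cluster_subseq:
  assumes "weakstar_cluster (\<lambda>j. h (r j)) g" "strict_mono r"
  shows "weakstar_cluster h g"
  unfolding weakstar_cluster_def
proof (intro allI impI)
  fix F :: "'a set" and e :: real and N assume "finite F" "e > 0"
  then obtain k where "k \<ge> N" "\<And>f. f \<in> F \<Longrightarrow> \<bar>g f - h (r k) f\<bar> < e"
    using weakstar_clusterD[OF assms(1)] by metis
  then show "\<exists>k\<ge>N. \<forall>f\<in>F. \<bar>g f - h k f\<bar> < e"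
    using seq_suble[OF assms(2), of k] by (meson order_trans)
qed

lemma clust_subseq: "strict_mono r \<Longrightarrow> clust (x \<circ> r) \<subseteq> clust x"
  using weakstar_cluster_subseq[of "\<lambda>k. canon (x k)" r] by (auto simp: clust_eq_weakstar_cluster)

text \<open>Banach-Alaoglu for sequences: by Tychonoff the \<open>h n\<close> lie in a compact
  product of intervals and have a pointwise cluster point. Linearity survives because each identity
  concerns finitely many arguments; the bound is membership in the product.\<close>

lemma weakstar_cluster_exists:
  fixes h :: "nat \<Rightarrow> 'b::real_normed_vector \<Rightarrow>\<^sub>L real"
  assumes bd: "\<And>n. norm (h n) \<le> C"
  obtains g where "weakstar_cluster h g"
proof -
  define K where "K = (\<Pi>\<^sub>E f\<in>(UNIV::'b set). cball (0::real) (C * norm f))"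
  have "compactin (product_topology (\<lambda>_. euclidean) UNIV) K"
    unfolding K_def by (auto simp: compactin_PiE)
  then have "compact K"
    by (simp add: euclidean_product_topology)
  have "norm (h n f) \<le> C * norm f" for n f
    using norm_blinfun[of "h n" f] mult_right_mono[OF bd[of n] norm_ge_zero[of f]] by linarith
  then have "eventually (\<lambda>y. y \<in> K) (filtermap (\<lambda>n. blinfun_apply (h n)) sequentially)"
    by (simp add: eventually_filtermap K_def PiE_iff)
  moreover have "filtermap (\<lambda>n. blinfun_apply (h n)) sequentially \<noteq> bot"
    by (simp add: filtermap_bot_iff)
  ultimately obtain G where "G \<in> K"
    and G: "inf (nhds G) (filtermap (\<lambda>n. blinfun_apply (h n)) sequentially) \<noteq> bot"
    using \<open>compact K\<close> unfolding compact_filter by blast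
  have close: "\<exists>k\<ge>N. \<forall>f\<in>F. \<bar>G f - h k f\<bar> < e" if "finite F" "e > 0" for F e N
  proof (rule ccontr)
    \<comment> \<open>Failure means that the basic neighbourhood \<open>U\<close> of
      \<open>G\<close> is avoided from index \<open>N\<close> on, contrary to the choice of
      \<open>G\<close>.\<close>
    assume *: "\<not> ?thesis"
    define U where "U = {y :: 'b \<Rightarrow> real. \<forall>f\<in>F. \<bar>G f - y f\<bar> < e}"
    have "open (\<Inter>f\<in>F. {y :: 'b \<Rightarrow> real. \<bar>G f - y f\<bar> < e})"
      using \<open>finite F\<close> by (intro open_INT ballI open_Collect_less continuous_intros) auto
    also have "(\<Inter>f\<in>F. {y :: 'b \<Rightarrow> real. \<bar>G f - y f\<bar> < e}) = U"
      by (auto simp: U_def)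
    finally have "eventually (\<lambda>y. y \<in> U) (nhds G)"
      using \<open>e > 0\<close> by (auto simp: eventually_nhds U_def)
    moreover have "eventually (\<lambda>y. y \<notin> U) (filtermap (\<lambda>n. blinfun_apply (h n)) sequentially)"
      using * by (auto simp: eventually_filtermap eventually_sequentially U_def)
    ultimately have "eventually (\<lambda>y. False) (inf (nhds G) (filtermap (\<lambda>n. blinfun_apply (h n)) sequentially))"
      unfolding eventually_inf by blast
    with G show False
      by (simp add: trivial_limit_def)
  qed
  have "bounded_linear G"
  proof (rule bounded_linear_intro)
    fix x y :: 'b
    have "\<bar>G (x + y) - (G x + G y)\<bar> \<le> e" if e: "e > 0" for e
    proof -
      obtain k where "\<bar>G x - h k x\<bar> < e / 3" "\<bar>G y - h k y\<bar> < e / 3" "\<bar>G (x + y) - h k (x + y)\<bar> < e / 3"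
        using close[of "{x, y, x + y}" "e / 3" 0] e by auto
      then show ?thesis
        unfolding blinfun.add_right by linarith
    qed
    then show "G (x + y) = G x + G y"
      by (metis dense_ge abs_le_zero_iff eq_iff_diff_eq_0)
  next
    fix c :: real and x :: 'b
    have "\<bar>G (c *\<^sub>R x) - c * G x\<bar> \<le> e" if e: "e > 0" for e
    proof -
      have pos: "e / (2 * (\<bar>c\<bar> + 1)) > 0" using e by simp
      obtain k where k: "\<bar>G (c *\<^sub>R x) - h k (c *\<^sub>R x)\<bar> < min (e/2) (e / (2 * (\<bar>c\<bar> + 1)))"
        "\<bar>G x - h k x\<bar> < min (e/2) (e / (2 * (\<bar>c\<bar> + 1)))"
        using close[of "{x, c *\<^sub>R x}" "min (e/2) (e / (2 * (\<bar>c\<bar> + 1)))" 0] e pos by auto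
      have "\<bar>c * G x - c * h k x\<bar> = \<bar>c\<bar> * \<bar>G x - h k x\<bar>"
        by (simp add: abs_mult flip: right_diff_distrib)
      also have "\<dots> \<le> (\<bar>c\<bar> + 1) * (e / (2 * (\<bar>c\<bar> + 1)))"
        using k by (intro mult_mono) auto
      also have "\<dots> = e / 2"
        by (simp add: field_simps add_pos_nonneg)
      finally show ?thesis
        using k(1) unfolding blinfun.scaleR_right real_scaleR_def min_less_iff_conj by linarith
    qed
    then have "G (c *\<^sub>R x) = c * G x"
      by (metis dense_ge abs_le_zero_iff eq_iff_diff_eq_0)
    then show "G (c *\<^sub>R x) = c *\<^sub>R G x"
      by simp
  next
    fix x :: 'b
    show "norm (G x) \<le> norm x * C"
      using \<open>G \<in> K\<close> by (auto simp: K_def mult.commute)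
  qed
  then have "weakstar_cluster h (Blinfun G)"
    using close by (simp add: weakstar_cluster_def bounded_linear_Blinfun_apply)
  then show ?thesis
    using that by blast
qed

lemma norm_weakstar_cluster_le:
  assumes "weakstar_cluster h g" "\<And>n. norm (h n) \<le> C"
  shows "norm g \<le> C"
proof (rule ccontr)
  assume "\<not> ?thesis"
  moreover have "0 \<le> C"
    using assms(2) norm_ge_zero order_trans by blast
  ultimately obtain f where f: "norm f \<le> 1" "C < g f"
    using norm_blinfun_less_witness[of C g] by auto
  have "g f \<le> C"
    using blinfun_apply_le_norm[OF f(1)] assms(2)
    by (intro weakstar_cluster_le[OF assms(1), of 0]) (meson abs_le_D1 order_trans)
  with f show False by simp
qed

section \<open>Goldstine's theorem for finitely many functionals\<close>

text \<open>The proof is a gradient step: at a near-minimiser \<open>h\<close> of \<open>\<Sum>\<^sub>z (\<phi> z - z h)\<^sup>2\<close> over the ball,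
  the functional \<open>\<Sum>\<^sub>z (\<phi> z - z h) z\<close> almost attains its norm at \<open>h\<close>.\<close>
lemma goldstine:
  fixes \<phi> :: "('b::real_normed_vector \<Rightarrow>\<^sub>L real) \<Rightarrow> real"
  assumes \<phi>: "linear \<phi>" "\<And>z. \<phi> z \<le> norm z" and Z: "finite Z" and "e > 0"
  obtains h where "norm h \<le> 1" "\<And>z. z \<in> Z \<Longrightarrow> \<bar>\<phi> z - z h\<bar> < e"
proof -
  define q where "q h = (\<Sum>z\<in>Z. (\<phi> z - z h)\<^sup>2)" for h
  define D where "D = (INF h\<in>cball 0 1. q h)"
  have bdd: "bdd_below (q ` cball 0 1)"
    by (intro bdd_belowI[of _ 0]) (auto simp: q_def sum_nonneg)
  have "D < e\<^sup>2"
  proof (rule ccontr)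
    assume "\<not> D < e\<^sup>2"
    then have "D > 0" using \<open>e > 0\<close> by (smt (verit) zero_less_power)
    define K where "K = (\<Sum>z\<in>Z. (2 * norm z)\<^sup>2)"
    have "K \<ge> 0" by (simp add: K_def sum_nonneg)
    \<comment> \<open>The step is so short that the second-order term of \<open>q\<close> along the
      segment from \<open>h\<close> to \<open>g\<close>, at most \<open>\<tau>\<^sup>2 * K\<close>,
      does not exceed \<open>\<tau> * (D / 2)\<close>.\<close>
    define \<tau> where "\<tau> = min 1 (D / (2 * (K + 1)))"
    have \<tau>: "0 < \<tau>" "\<tau> \<le> 1"
      using \<open>D > 0\<close> \<open>K \<ge> 0\<close> by (auto simp: \<tau>_def)
    have "\<tau> * K \<le> D / (2 * (K + 1)) * (K + 1)"
      using \<open>K \<ge> 0\<close> \<open>D > 0\<close> by (intro mult_mono) (auto simp: \<tau>_def)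
    also have "\<dots> = D / 2"
      using \<open>K \<ge> 0\<close> by (simp add: field_simps)
    finally have \<tau>K: "\<tau> * K \<le> D / 2" .
    \<comment> \<open>The slack in near-minimality carries the factor \<open>\<tau>\<close> because
      the first-order estimate is later divided by \<open>\<tau>\<close>.\<close>
    have "D < D + \<tau> * (D / 2)" using \<tau> \<open>D > 0\<close> by simp
    then obtain h where h: "norm h \<le> 1" "q h < D + \<tau> * (D / 2)"
      unfolding D_def using bdd by (subst (asm) cINF_less_iff) auto
    define a where "a z = \<phi> z - z h" for z
    define A where "A = (\<Sum>z\<in>Z. a z *\<^sub>R z)"
    have A_apply: "A g = (\<Sum>z\<in>Z. a z * z g)" for g
      by (simp add: A_def blinfun.sum_left blinfun.scaleR_left)
    have A_le: "A g \<le> A h + D / 2" if "norm g \<le> 1" for g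
    proof -
      have "(1 - \<tau>) *\<^sub>R h + \<tau> *\<^sub>R g \<in> cball 0 1"
        using h(1) that \<tau> by (intro convexD[OF convex_cball]) auto
      moreover have "(1 - \<tau>) *\<^sub>R h + \<tau> *\<^sub>R g = h + \<tau> *\<^sub>R (g - h)"
        by (simp add: algebra_simps)
      ultimately have "D \<le> q (h + \<tau> *\<^sub>R (g - h))"
        unfolding D_def by (intro cINF_lower[OF bdd]) auto
      also have "\<dots> = (\<Sum>z\<in>Z. (a z)\<^sup>2 - 2 * \<tau> * (a z * z (g - h)) + \<tau>\<^sup>2 * (z (g - h))\<^sup>2)"
        unfolding q_def a_def
        by (intro sum.cong refl)
          (simp add: blinfun.add_right blinfun.scaleR_right,
            simp add: power2_eq_square algebra_simps)
      also have "\<dots> = q h - 2 * \<tau> * A (g - h) + \<tau>\<^sup>2 * (\<Sum>z\<in>Z. (blinfun_apply z (g - h))\<^sup>2)"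
        by (simp add: q_def a_def A_apply sum.distrib sum_subtractf sum_distrib_left)
      also have "(\<Sum>z\<in>Z. (blinfun_apply z (g - h))\<^sup>2) \<le> K"
        unfolding K_def
      proof (rule sum_mono)
        fix z :: "'b \<Rightarrow>\<^sub>L real"
        have "\<bar>z (g - h)\<bar> \<le> \<bar>2 * norm z\<bar>"
          using blinfun_apply_le_norm[OF h(1), of z] blinfun_apply_le_norm[OF that, of z]
          by (auto simp: blinfun.diff_right)
        then show "(z (g - h))\<^sup>2 \<le> (2 * norm z)\<^sup>2"
          by (simp only: abs_le_square_iff)
      qed
      finally have "2 * \<tau> * A (g - h) \<le> q h - D + \<tau> * (\<tau> * K)"
        using \<tau> by (simp add: power2_eq_square mult.assoc)
      also have "\<dots> \<le> \<tau> * (D / 2) + \<tau> * (D / 2)"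
        using h(2) \<tau> \<tau>K by (intro add_mono mult_left_mono) auto
      finally have "\<tau> * (2 * A (g - h)) \<le> \<tau> * D"
        by (simp add: algebra_simps)
      then have "2 * A (g - h) \<le> D"
        using \<tau> by simp
      then show ?thesis
        by (simp add: blinfun.diff_right)
    qed
    have "norm A \<le> A h + D / 2"
    proof (rule ccontr)
      assume "\<not> ?thesis"
      moreover have "0 \<le> A h + D / 2"
        using A_le[of 0] by (simp add: blinfun.zero_right)
      ultimately show False
        using norm_blinfun_less_witness[of "A h + D / 2" A] A_le by (metis not_le)
    qed
    \<comment> \<open>The contradiction is \<open>\<phi> A = A h + q h \<ge> A h + D > A h + D / 2
      \<ge> norm A\<close>.\<close>
    moreover have "\<phi> A - A h = q h"
    proof -
      have "\<phi> A = (\<Sum>z\<in>Z. a z * \<phi> z)"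
        by (simp add: A_def linear_sum[OF \<phi>(1)] linear_cmul[OF \<phi>(1)])
      then have "\<phi> A - A h = (\<Sum>z\<in>Z. a z * (\<phi> z - z h))"
        by (simp add: A_apply sum_subtractf right_diff_distrib)
      then show ?thesis
        by (simp add: q_def a_def power2_eq_square)
    qed
    moreover have "D \<le> q h"
      unfolding D_def using h(1) by (intro cINF_lower[OF bdd]) auto
    ultimately show False
      using \<phi>(2)[of A] \<open>D > 0\<close> by linarith
  qed
  then obtain h where h: "norm h \<le> 1" "q h < e\<^sup>2"
    unfolding D_def using bdd by (subst (asm) cINF_less_iff) auto
  have "\<bar>\<phi> z - z h\<bar> < e" if "z \<in> Z" for z
  proof -
    have "(\<phi> z - z h)\<^sup>2 \<le> q h"
      unfolding q_def by (rule member_le_sum[OF that]) (auto simp: Z)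
    with h(2) have "\<bar>\<phi> z - z h\<bar>\<^sup>2 < e\<^sup>2" by simp
    then show ?thesis
      using \<open>e > 0\<close> by (intro power_less_imp_less_base[of _ 2 e]) auto
  qed
  with h(1) show ?thesis
    using that by blast
qed

section \<open>Combinatorics of infinite index sets\<close>

text \<open>\<open>A f k\<close> and \<open>B f k\<close> stand for \<open>f\<close> being high and
  low at index \<open>k\<close>; keeping them abstract leaves pure combinatorics.\<close>

definition oscillates :: "('f \<Rightarrow> nat \<Rightarrow> bool) \<Rightarrow> ('f \<Rightarrow> nat \<Rightarrow> bool) \<Rightarrow> nat set \<Rightarrow> 'f \<Rightarrow> bool" where
  "oscillates A B N f \<longleftrightarrow> infinite {k\<in>N. A f k} \<and> infinite {k\<in>N. B f k}"

lemma oscillates_cofinite: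
  assumes "oscillates A B N f" "finite (N - N')"
  shows "oscillates A B N' f"
proof -
  have "infinite {k\<in>N'. Q k}" if "infinite {k\<in>N. Q k}" for Q
  proof
    assume "finite {k\<in>N'. Q k}"
    with assms(2) have "finite ({k\<in>N'. Q k} \<union> (N - N'))"
      by simp
    then have "finite {k\<in>N. Q k}"
      by (rule rev_finite_subset) auto
    with that show False by simp
  qed
  then show ?thesis
    using assms(1) unfolding oscillates_def by blast
qed

lemma oscillates_mono: "oscillates A B N f \<Longrightarrow> N \<subseteq> N' \<Longrightarrow> oscillates A B N' f"
  by (rule oscillates_cofinite, assumption) (metis Diff_eq_empty_iff finite.emptyI)

text \<open>Induction on \<open>R\<close>: if \<open>r\<close> fails on some infinite
  \<open>L\<close>, monotonicity makes it fail on every subset of \<open>L\<close>, so inside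
  \<open>L\<close> the remaining indices already suffice.\<close>

lemma finite_index_stabilizes:
  assumes "finite R" "infinite M"
    and "\<And>N. N \<subseteq> M \<Longrightarrow> infinite N \<Longrightarrow> \<exists>r\<in>R. G r N"
    and mono: "\<And>r N N'. G r N \<Longrightarrow> N \<subseteq> N' \<Longrightarrow> G r N'"
  shows "\<exists>r\<in>R. \<exists>M'\<subseteq>M. infinite M' \<and> (\<forall>N\<subseteq>M'. infinite N \<longrightarrow> G r N)"
  using assms(1-3)
proof (induction R arbitrary: M rule: finite_induct)
  case empty
  then show ?case by blast
next
  case (insert r R)
  show ?case
  proof (cases "\<forall>N\<subseteq>M. infinite N \<longrightarrow> G r N")
    case True
    with insert.prems show ?thesis by blast
  next
    case False
    then obtain L where L: "L \<subseteq> M" "infinite L" "\<not> G r L"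
      by blast
    have "\<exists>s\<in>R. G s N" if "N \<subseteq> L" "infinite N" for N
      using insert.prems(2)[of N] that L mono[of r N L] by blast
    from insert.IH[OF L(2) this] L(1) show ?thesis
      by (meson insertI2 order_trans)
  qed
qed

text \<open>Quantifying over all infinite \<open>N\<close> inside \<open>M\<close> makes the
  property hereditary, so \<open>M\<close> may be thinned at will. \<open>K\<close> holds the
  indices already selected, where \<open>f\<close> has to be high.\<close>

definition large where
  "large S A B K M \<longleftrightarrow> (\<forall>N\<subseteq>M. infinite N \<longrightarrow>
     (\<exists>f\<in>S. (\<forall>k\<in>K. A f k) \<and> oscillates A B N f))"

lemma large_mono: "large S A B K M \<Longrightarrow> M' \<subseteq> M \<Longrightarrow> large S A B K M'"
  unfolding large_def by blast

text \<open>If no \<open>p\<close> could be added to \<open>K\<close>, diagonalising over the failing sets would yield an infinite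
  set \<open>range p\<close> on which some \<open>f\<close> oscillates, although \<open>A f (p i)\<close> rules this out for every \<open>i\<close>.\<close>
lemma large_insert:
  assumes large: "large S A B K M" and "infinite M"
  obtains p M' where "p \<in> M" "M' \<subseteq> M" "infinite M'" "\<And>m. m \<in> M' \<Longrightarrow> p < m"
    "large S A B (insert p K) M'"
proof -
  define bad where "bad p N \<longleftrightarrow> \<not> (\<exists>f\<in>S. (\<forall>k\<in>insert p K. A f k) \<and> oscillates A B N f)" for p N
  have "\<exists>p\<in>M. \<exists>M'\<subseteq>M. infinite M' \<and> (\<forall>m\<in>M'. p < m) \<and> large S A B (insert p K) M'"
  proof (rule ccontr)
    assume contra: "\<not> ?thesis"
    \<comment> \<open>If the tail \<open>N \<inter> {p<..}\<close> were large for
      \<open>insert p K\<close>, it could serve as \<open>M'\<close>; so it contains an infinite set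
      bad for \<open>p\<close>.\<close>
    have step: "\<exists>N'\<subseteq>N. infinite N' \<and> (\<forall>m\<in>N'. p < m) \<and> bad p N'"
      if "N \<subseteq> M" "infinite N" "p \<in> M" for N p
    proof -
      have "N \<inter> {p<..} = N - {..p}" by auto
      then have "infinite (N \<inter> {p<..})"
        using that by simp
      moreover have "N \<inter> {p<..} \<subseteq> M" "\<forall>m\<in>N \<inter> {p<..}. p < m"
        using that by auto
      ultimately have "\<not> large S A B (insert p K) (N \<inter> {p<..})"
        using contra \<open>p \<in> M\<close> by blast
      then obtain N' where "N' \<subseteq> N \<inter> {p<..}" "infinite N'" "bad p N'"
        unfolding large_def bad_def by blast
      then show ?thesis by blast
    qed
    define P where "P = (\<lambda>(p, N). p \<in> M \<and> N \<subseteq> M \<and> infinite N \<and> (\<forall>m\<in>N. p < m) \<and> bad p N)"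
    have "\<exists>s. \<forall>n::nat. P (s n) \<and> (fst (s (Suc n)) \<in> snd (s n) \<and> snd (s (Suc n)) \<subseteq> snd (s n))"
    proof (rule dependent_nat_choice)
      obtain p where "p \<in> M"
        using infinite_imp_nonempty[OF \<open>infinite M\<close>] by blast
      then obtain N' where "N' \<subseteq> M" "infinite N'" "\<forall>m\<in>N'. p < m" "bad p N'"
        using step[of M p] \<open>infinite M\<close> by blast
      with \<open>p \<in> M\<close> have "P (p, N')"
        by (simp add: P_def)
      then show "\<exists>s. P s" by blast
    next
      fix s :: "nat \<times> nat set" and n :: nat
      assume "P s"
      obtain p N where s: "s = (p, N)" by force
      with \<open>P s\<close> have N: "N \<subseteq> M" "infinite N" by (auto simp: P_def)
      then obtain p' where p': "p' \<in> N"
        using infinite_imp_nonempty by blast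
      then obtain N' where "N' \<subseteq> N" "infinite N'" "\<forall>m\<in>N'. p' < m" "bad p' N'"
        using step[of N p'] N by blast
      then have "P (p', N') \<and> fst (p', N') \<in> snd s \<and> snd (p', N') \<subseteq> snd s"
        using s p' N by (auto simp: P_def)
      then show "\<exists>t. P t \<and> fst t \<in> snd s \<and> snd t \<subseteq> snd s" by blast
    qed
    then obtain s where sP: "\<And>n. P (s n)"
      and s_in: "\<And>n. fst (s (Suc n)) \<in> snd (s n)" and s_sub: "\<And>n. snd (s (Suc n)) \<subseteq> snd (s n)"
      by blast
    define p where "p n = fst (s n)" for n
    define N where "N n = snd (s n)" for n
    have p: "p n \<in> M" "m \<in> N n \<Longrightarrow> p n < m" "bad (p n) (N n)" for n m
      using sP[of n] by (auto simp: P_def p_def N_def split: prod.splits)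
    have decN: "N j \<subseteq> N i" if "i \<le> j" for i j
      using s_sub that unfolding N_def by (rule lift_Suc_antimono_le)
    have pN: "p j \<in> N i" if "i < j" for i j
    proof (cases j)
      case (Suc l)
      then have "p j \<in> N l" "N l \<subseteq> N i"
        using s_in[of l] decN[of i l] that by (auto simp: p_def N_def)
      then show ?thesis by blast
    qed (use that in simp)
    have "strict_mono p"
      by (rule strict_monoI) (use p(2) pN in blast)
    then have "infinite (range p)"
      by (simp add: range_inj_infinite strict_mono_imp_inj_on)
    moreover have "range p \<subseteq> M"
      using p(1) by blast
    ultimately obtain f where f: "f \<in> S" "\<forall>k\<in>K. A f k" "oscillates A B (range p) f"
      using large unfolding large_def by blast
    then have "{k\<in>range p. A f k} \<noteq> {}"
      unfolding oscillates_def by (intro infinite_imp_nonempty) blast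
    then obtain i where i: "A f (p i)" by blast
    \<comment> \<open>All points after \<open>p i\<close> lie in \<open>N i\<close>, so
      \<open>f\<close> still oscillates on \<open>N i\<close>. Being high at \<open>p i\<close>, it
      contradicts the badness of \<open>N i\<close>.\<close>
    have "range p - N i \<subseteq> p ` {..i}"
    proof
      fix v assume "v \<in> range p - N i"
      then obtain j where j: "v = p j" "p j \<notin> N i"
        by blast
      with pN[of i j] have "j \<le> i"
        using not_le by blast
      with j(1) show "v \<in> p ` {..i}"
        by simp
    qed
    then have "finite (range p - N i)"
      by (rule finite_subset) simp
    then have "oscillates A B (N i) f"
      by (rule oscillates_cofinite[OF f(3)])
    with p(3)[of i] f(1,2) i show False
      unfolding bad_def by blast
  qed
  then show ?thesis
    using that by blast
qed

text \<open>Greedy selection: take \<open>f\<close> high on the chosen indices and oscillating on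
  the reservoir, thin the reservoir to indices where \<open>f\<close> is low, and pick the next
  index there so that largeness is kept.\<close>

lemma separated_subsequence:
  assumes "large S A B {} M" "infinite M"
  obtains k :: "nat \<Rightarrow> nat" and f
  where "strict_mono k" "\<And>n. f n \<in> S" "\<And>n j. j < n \<Longrightarrow> A (f n) (k j)" "\<And>n j. n \<le> j \<Longrightarrow> B (f n) (k j)"
proof -
  define P where "P = (\<lambda>(K, M). infinite M \<and> large S A B K M)"
  \<comment> \<open>\<open>f\<close> is fixed before \<open>p\<close> is picked, so \<open>f\<close>
    is already low at \<open>p\<close>; this puts the case \<open>j = n\<close> on the side of
    \<open>B\<close>.\<close>
  define Q where "Q = (\<lambda>(K, M) (K', M') p f. f \<in> S \<and> (\<forall>j\<in>K. A f j) \<and> p \<in> M \<and> M' \<subseteq> M \<and>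
     (\<forall>m\<in>M'. p < m) \<and> K' = insert p K \<and> (\<forall>m\<in>insert p M'. B f m))"
  have "\<exists>s. \<forall>n::nat. P (s n) \<and> (\<exists>p f. Q (s n) (s (Suc n)) p f)"
  proof (rule dependent_nat_choice)
    show "\<exists>s. P s"
      using assms by (auto simp: P_def)
  next
    fix s :: "nat set \<times> nat set" and n :: nat
    assume "P s"
    obtain K M where s: "s = (K, M)" by force
    with \<open>P s\<close> have "infinite M" and large: "large S A B K M" by (auto simp: P_def)
    then obtain f where f: "f \<in> S" "\<forall>k\<in>K. A f k" "oscillates A B M f"
      unfolding large_def by blast
    define M1 where "M1 = {m\<in>M. B f m}"
    have "infinite M1" "M1 \<subseteq> M"
      using f(3) by (auto simp: M1_def oscillates_def)
    then obtain p M' where "p \<in> M1" "M' \<subseteq> M1" "infinite M'" "\<And>m. m \<in> M' \<Longrightarrow> p < m"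
      "large S A B (insert p K) M'"
      using large_insert large_mono[OF large] by metis
    then have "P (insert p K, M') \<and> Q s (insert p K, M') p f"
      using f s by (auto simp: P_def Q_def M1_def)
    then show "\<exists>t. P t \<and> (\<exists>p f. Q s t p f)" by blast
  qed
  then obtain s where sP: "\<And>n. P (s n)" and "\<And>n. \<exists>p f. Q (s n) (s (Suc n)) p f"
    by blast
  then obtain k f where Q: "\<And>n. Q (s n) (s (Suc n)) (k n) (f n)"
    by metis
  define K where "K n = fst (s n)" for n
  define M where "M n = snd (s n)" for n
  have S: "f n \<in> S" and A: "\<And>j. j \<in> K n \<Longrightarrow> A (f n) j" and kM: "k n \<in> M n"
    and M_Suc: "M (Suc n) \<subseteq> M n" and less: "\<And>m. m \<in> M (Suc n) \<Longrightarrow> k n < m"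
    and K_Suc: "K (Suc n) = insert (k n) (K n)"
    and B: "B (f n) (k n)" "\<And>m. m \<in> M (Suc n) \<Longrightarrow> B (f n) m" for n
    using Q[of n] by (auto simp: Q_def K_def M_def split: prod.splits)
  have decM: "M j \<subseteq> M i" if "i \<le> j" for i j
    using M_Suc that by (rule lift_Suc_antimono_le)
  have kM': "k j \<in> M (Suc i)" if "i < j" for i j
    using kM[of j] decM[of "Suc i" j] that by auto
  have kK: "k j \<in> K n" if "j < n" for j n
    using that by (induction n) (auto simp: K_Suc less_Suc_eq)
  show ?thesis
  proof
    show "strict_mono k"
      by (rule strict_monoI) (use less kM' in blast)
    show "B (f n) (k j)" if "n \<le> j" for n j
      using B kM' that by (cases "n = j") auto
  qed (use S A kK in auto)
qed

section \<open>Cluster sets in the bidual and their diameters\<close>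

lemma norm_clust_le:
  assumes "z \<in> clust x" "\<And>n. norm (x n) \<le> C"
  shows "norm z \<le> C"
proof (rule norm_weakstar_cluster_le[of "\<lambda>k. canon (x k)"])
  show "weakstar_cluster (\<lambda>k. canon (x k)) z"
    using assms(1) by (simp add: clust_eq_weakstar_cluster)
  show "norm (canon (x n)) \<le> C" for n
    using norm_canon_le[of "x n"] assms(2)[of n] by simp
qed

lemma clust_nonempty:
  assumes "bounded (range x)"
  shows "clust x \<noteq> {}"
proof -
  obtain C where C: "norm (x n) \<le> C" for n
    using assms by (auto simp: bounded_iff)
  have "norm (canon (x n)) \<le> C" for n
    using norm_canon_le[of "x n"] C[of n] by simp
  then obtain z where "weakstar_cluster (\<lambda>k. canon (x k)) z"
    by (rule weakstar_cluster_exists)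
  then show ?thesis
    by (auto simp: clust_eq_weakstar_cluster)
qed

lemma bounded_clust:
  assumes "bounded (range x)"
  shows "bounded (clust x)"
proof -
  obtain C where "norm (x n) \<le> C" for n
    using assms by (auto simp: bounded_iff)
  then show ?thesis
    using norm_clust_le[of _ x C] by (intro boundedI[of _ C]) auto
qed

lemma bounded_range_comp: "bounded (range x) \<Longrightarrow> bounded (range (x \<circ> r))"
  by (rule bounded_subset) auto

lemma delta_X_nonneg:
  assumes "bounded (range x)"
  shows "0 \<le> delta_X x"
  unfolding delta_X_def by (rule diameter_ge_0[OF bounded_clust[OF assms]])

lemma clust_apply_ge:
  fixes f :: "'a::real_normed_vector \<Rightarrow>\<^sub>L real"
  assumes "z \<in> clust x" "\<And>k. c \<le> f (x k)"
  shows "c \<le> z f"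
  using weakstar_cluster_ge[of "\<lambda>k. canon (x k)" z 0 c f] assms by (simp add: clust_eq_weakstar_cluster)

lemma clustD:
  fixes f :: "'a::real_normed_vector \<Rightarrow>\<^sub>L real"
  assumes "z \<in> clust x" "e > 0"
  obtains k where "k \<ge> N" "\<bar>z f - f (x k)\<bar> < e"
  using weakstar_clusterD[of "\<lambda>k. canon (x k)" z "{f}" e N] assms
  by (auto simp: clust_eq_weakstar_cluster)

lemma clust_infinite_ge:
  fixes f :: "'a::real_normed_vector \<Rightarrow>\<^sub>L real"
  assumes "z \<in> clust x" "c < z f"
  shows "infinite {k. c \<le> f (x k)}"
  unfolding infinite_nat_iff_unbounded_le
proof
  fix m
  obtain k where "k \<ge> m" "\<bar>z f - f (x k)\<bar> < z f - c"
    using clustD[OF assms(1), of "z f - c" m f] assms(2) by auto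
  then show "\<exists>n\<ge>m. n \<in> {k. c \<le> f (x k)}"
    by (intro exI[of _ k]) auto
qed

lemma clust_infinite_le:
  fixes f :: "'a::real_normed_vector \<Rightarrow>\<^sub>L real"
  assumes "z \<in> clust x" "z f < c"
  shows "infinite {k. f (x k) \<le> c}"
  using clust_infinite_ge[OF assms(1), of "- c" "- f"] assms(2) by (simp add: blinfun.minus_left blinfun.minus_right)

text \<open>The indices satisfying the bound form a subsequence; its cluster points exist, inherit
  the bound and belong to \<open>clust x\<close>.\<close>

lemma clust_witness_ge:
  fixes f :: "'a::real_normed_vector \<Rightarrow>\<^sub>L real"
  assumes bd: "bounded (range x)" and inf: "infinite {k. c \<le> f (x k)}"
  obtains z where "z \<in> clust x" "c \<le> z f"
proof -
  obtain r :: "nat \<Rightarrow> nat" where r: "strict_mono r" "\<And>n. c \<le> f (x (r n))"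
    using infinite_enumerate[OF inf] by auto
  obtain z where z: "z \<in> clust (x \<circ> r)"
    using clust_nonempty[OF bounded_range_comp[OF bd]] by blast
  then have "c \<le> z f"
    by (rule clust_apply_ge) (simp add: r)
  with z show ?thesis
    using that clust_subseq[OF r(1)] by blast
qed

text \<open>Each of the two levels is realised by a cluster point. This bounds
  \<open>limsup - liminf\<close> of \<open>f (x k)\<close> by the diameter.\<close>

lemma delta_X_ge:
  fixes f :: "'a::real_normed_vector \<Rightarrow>\<^sub>L real"
  assumes bd: "bounded (range x)" and f: "norm f \<le> 1"
    and "infinite {k. a \<le> f (x k)}" "infinite {k. f (x k) \<le> b}"
  shows "a - b \<le> delta_X x"
proof -
  obtain z where z: "z \<in> clust x" "a \<le> z f"
    using clust_witness_ge[OF bd assms(3)] by blast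
  obtain w where w: "w \<in> clust x" "- b \<le> w (- f)"
    using clust_witness_ge[OF bd, of "- b" "- f"] assms(4) unfolding blinfun.minus_left neg_le_iff_le by blast
  have "a - b \<le> (z - w) f"
    using z w by (simp add: blinfun.minus_right blinfun.diff_left)
  also have "\<dots> \<le> dist z w"
    using blinfun_apply_le_norm[OF f, of "z - w"] by (simp add: dist_norm)
  also have "\<dots> \<le> delta_X x"
    unfolding delta_X_def using z w by (intro diameter_bounded_bound bounded_clust[OF bd])
  finally show ?thesis .
qed

text \<open>The converse estimate: two nearly diametral cluster points are separated by a functional
  in the unit ball.\<close>

lemma delta_X_gt_witness:
  assumes "0 \<le> d" "d < delta_X x"
  obtains z w f where "z \<in> clust x" "w \<in> clust x" "norm f \<le> 1" "d < z f - w f"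
proof -
  obtain z w where zw: "z \<in> clust x" "w \<in> clust x" "d < norm (z - w)"
    using diameter_le[of "clust x" d] assms unfolding delta_X_def by (metis not_le)
  moreover obtain f where "norm f \<le> 1" "d < (z - w) f"
    using norm_blinfun_less_witness[OF assms(1) zw(3)] by blast
  ultimately show ?thesis
    using that by (simp add: blinfun.diff_left)
qed

lemma delta_tilde_le:
  assumes "bounded (range x)" "strict_mono r"
  shows "delta_tilde x \<le> delta_X (x \<circ> r)"
  unfolding delta_tilde_def using assms delta_X_nonneg[OF bounded_range_comp[OF assms(1)]]
  by (intro cINF_lower bdd_belowI2[of _ 0]) auto

lemma bdd_above_infdist_clust:
  assumes "bounded (range x)"
  shows "bdd_above ((\<lambda>z. infdist z (range canon)) ` clust x)"
proof -
  obtain C where C: "norm z \<le> C" if "z \<in> clust x" for z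
    using bounded_clust[OF assms] by (auto simp: bounded_iff)
  show ?thesis
  proof (rule bdd_aboveI2)
    fix z assume "z \<in> clust x"
    have "infdist z (range canon) \<le> dist z (canon 0)"
      by (rule infdist_le) (rule rangeI)
    also have "\<dots> \<le> C"
      using C[OF \<open>z \<in> clust x\<close>] by simp
    finally show "infdist z (range canon) \<le> C" .
  qed
qed

section \<open>The inequality valid in every space\<close>

text \<open>Along every subsequence some functional oscillates by more than \<open>d'\<close>, but
  around a level depending on the subsequence. Rounding levels to a finite grid and thinning fixes
  one \<open>r\<close>, after which the greedy selection applies.\<close>

lemma oscillating_functionals:
  fixes x :: "nat \<Rightarrow> 'a::real_normed_vector"
  assumes bd: "bounded (range x)" and d: "0 \<le> d'" "d' < delta_tilde x"
  obtains r :: real and k :: "nat \<Rightarrow> nat" and f :: "nat \<Rightarrow> 'a \<Rightarrow>\<^sub>L real"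
  where "strict_mono k" "\<And>n. norm (f n) \<le> 1"
    "\<And>n j. j < n \<Longrightarrow> r + d' \<le> f n (x (k j))" "\<And>n j. n \<le> j \<Longrightarrow> f n (x (k j)) \<le> r"
proof -
  obtain C where C: "norm (x n) \<le> C" for n
    using bd by (auto simp: bounded_iff)
  \<comment> \<open>The gap \<open>\<eta>\<close> between \<open>d'\<close> and \<open>d\<close>
    serves as grid step and pays for rounding the level.\<close>
  define d where "d = (d' + delta_tilde x) / 2"
  define \<eta> where "\<eta> = d - d'"
  have dd: "d' < d" "d < delta_tilde x" "\<eta> > 0"
    using d by (auto simp: d_def \<eta>_def)
  define R where "R = (\<lambda>i. - C + real i * \<eta>) ` {..nat \<lfloor>2 * C / \<eta>\<rfloor> + 1}"
  define S where "S = {f :: 'a \<Rightarrow>\<^sub>L real. norm f \<le> 1}"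
  define A where "A r f k \<longleftrightarrow> r + d' \<le> blinfun_apply f (x k)" for r f k
  define B where "B r f k \<longleftrightarrow> blinfun_apply f (x k) \<le> r" for r :: real and f k
  have ex: "\<exists>r\<in>R. \<exists>f\<in>S. oscillates (A r) (B r) N f" if N: "infinite N" for N
  proof -
    obtain s :: "nat \<Rightarrow> nat" where s: "strict_mono s" "\<And>n. s n \<in> N"
      using infinite_enumerate[OF N] by blast
    have "0 \<le> d" "d < delta_X (x \<circ> s)"
      using delta_tilde_le[OF bd s(1)] dd \<open>0 \<le> d'\<close> by linarith+
    then obtain z w f where zw: "z \<in> clust (x \<circ> s)" "w \<in> clust (x \<circ> s)" and f: "norm f \<le> 1" "d < z f - w f"
      by (rule delta_X_gt_witness)
    have "\<bar>w f\<bar> \<le> C"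
      using blinfun_apply_le_norm[OF f(1), of w] norm_clust_le[OF zw(2), of C] C by auto
    \<comment> \<open>This makes \<open>r\<close> the first grid point strictly above
      \<open>w f\<close>, at most \<open>\<eta>\<close> away, so
      \<open>r + d' \<le> w f + d < z f\<close>. The \<open>+ 1\<close> matches the one in
      \<open>R\<close>.\<close>
    define i where "i = nat \<lfloor>(w f + C) / \<eta>\<rfloor> + 1"
    define r where "r = - C + real i * \<eta>"
    have "(w f + C) / \<eta> \<le> 2 * C / \<eta>"
      using \<open>\<bar>w f\<bar> \<le> C\<close> dd(3) by (intro divide_right_mono) auto
    then have "r \<in> R"
      unfolding R_def r_def i_def by (intro imageI) (auto intro!: nat_mono floor_mono)
    have "0 \<le> (w f + C) / \<eta>"
      using \<open>\<bar>w f\<bar> \<le> C\<close> dd(3) by auto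
    then have i: "real i - 1 \<le> (w f + C) / \<eta>" "(w f + C) / \<eta> < real i"
      unfolding i_def by linarith+
    have "w f < r" "r \<le> w f + \<eta>"
      using i dd(3) by (auto simp: r_def field_simps)
    then have "r + d' < z f"
      using f(2) by (auto simp: \<eta>_def)
    have img: "infinite {k\<in>N. Q k}" if "infinite {n. Q (s n)}" for Q
    proof -
      have "infinite (s ` {n. Q (s n)})"
        using that s(1) by (simp add: finite_image_iff inj_on_def strict_mono_eq)
      moreover have "s ` {n. Q (s n)} \<subseteq> {k\<in>N. Q k}"
        using s(2) by auto
      ultimately show ?thesis
        using finite_subset by blast
    qed
    have "oscillates (A r) (B r) N f"
      unfolding oscillates_def A_def B_def
      using clust_infinite_ge[OF zw(1) \<open>r + d' < z f\<close>] clust_infinite_le[OF zw(2) \<open>w f < r\<close>]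
      by (auto intro!: img)
    with \<open>r \<in> R\<close> f(1) show ?thesis
      by (auto simp: S_def)
  qed
  have "finite R" by (simp add: R_def)
  then have "\<exists>r\<in>R. \<exists>M\<subseteq>UNIV. infinite M \<and> (\<forall>N\<subseteq>M. infinite N \<longrightarrow> (\<exists>f\<in>S. oscillates (A r) (B r) N f))"
    by (rule finite_index_stabilizes) (use ex in \<open>auto intro: oscillates_mono\<close>)
  then obtain r M where "infinite M" "large S (A r) (B r) {} M"
    by (auto simp: large_def)
  then obtain k :: "nat \<Rightarrow> nat" and f where k: "strict_mono k" "\<And>n. f n \<in> S"
    "\<And>n j. j < n \<Longrightarrow> A r (f n) (k j)" "\<And>n j. n \<le> j \<Longrightarrow> B r (f n) (k j)"
    using separated_subsequence by metis
  show ?thesis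
    by (rule that[of k f r]) (use k in \<open>auto simp: S_def A_def B_def\<close>)
qed

lemma delta_tilde_le_dhat:
  fixes x :: "nat \<Rightarrow> 'a::real_normed_vector"
  assumes bd: "bounded (range x)"
  shows "delta_tilde x \<le> 2 * set_dhat (clust x) (range canon)"
proof (rule ccontr)
  define c where "c = set_dhat (clust x) (range canon)"
  assume "\<not> ?thesis"
  then have less: "2 * c < delta_tilde x" by (simp add: c_def)
  have le_c: "infdist z (range canon) \<le> c" if "z \<in> clust x" for z
    unfolding c_def set_dhat_def by (rule cSUP_upper[OF that bdd_above_infdist_clust[OF bd]])
  have "0 \<le> c"
    using clust_nonempty[OF bd] le_c infdist_nonneg by (meson all_not_in_conv order_trans)
  \<comment> \<open>As \<open>c < d / 2\<close> is strict, some \<open>y\<close> has distance below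
    \<open>d / 2\<close> from \<open>z\<close> even if the infimum is not attained.\<close>
  define d where "d = (2 * c + delta_tilde x) / 2"
  have d: "0 \<le> d" "2 * c < d" "d < delta_tilde x"
    using less \<open>0 \<le> c\<close> by (auto simp: d_def)
  obtain r :: real and k :: "nat \<Rightarrow> nat" and f :: "nat \<Rightarrow> 'a \<Rightarrow>\<^sub>L real"
    where k: "strict_mono k" and f: "\<And>n. norm (f n) \<le> 1"
    and ge: "\<And>n j. j < n \<Longrightarrow> r + d \<le> f n (x (k j))" and le: "\<And>n j. n \<le> j \<Longrightarrow> f n (x (k j)) \<le> r"
    by (rule oscillating_functionals[OF bd d(1,3)]) (rule that)
  obtain z where z: "z \<in> clust (x \<circ> k)"
    using clust_nonempty[OF bounded_range_comp[OF bd]] by blast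
  then have zc: "weakstar_cluster (\<lambda>j. canon (x (k j))) z"
    by (simp add: clust_eq_weakstar_cluster)
  have "z \<in> clust x"
    using clust_subseq[OF k] z by blast
  then have "infdist z (range canon) < d / 2"
    using le_c[of z] d(2) by simp
  then obtain y where y: "norm (z - canon y) < d / 2"
    by (subst (asm) infdist_notempty, simp, subst (asm) cINF_less_iff) (auto simp: dist_norm intro: bdd_belowI2[of _ 0])
  have near: "\<bar>z g - g y\<bar> < d / 2" if "norm g \<le> 1" for g
    using blinfun_apply_le_norm[OF that, of "z - canon y"] y by (simp add: blinfun.diff_left)
  obtain g where g: "weakstar_cluster f g"
    using weakstar_cluster_exists[of f 1, OF f] by blast
  have "norm g \<le> 1"
    by (rule norm_weakstar_cluster_le[OF g f])
  \<comment> \<open>The final chain is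
    \<open>r + d \<le> z g < g y + d / 2 \<le> r + e + d / 2 < r + d\<close>.\<close>
  define e where "e = norm (z - canon y)"
  have "f n y \<le> r + e" for n
  proof -
    have "z (f n) \<le> r"
      by (rule weakstar_cluster_le[OF zc, of n]) (simp add: le)
    moreover have "\<bar>z (f n) - f n y\<bar> \<le> e"
      using blinfun_apply_le_norm[OF f, of "z - canon y" n] by (simp add: blinfun.diff_left e_def)
    ultimately show ?thesis by linarith
  qed
  then have "g y \<le> r + e"
    by (intro weakstar_cluster_le[OF g])
  \<comment> \<open>For fixed \<open>j\<close>, the lower bound at \<open>x (k j)\<close> is
    available for \<open>f n\<close> with \<open>n > j\<close>, hence the start at
    \<open>Suc j\<close>.\<close>
  moreover have "r + d \<le> g (x (k j))" for j
    by (rule weakstar_cluster_ge[OF g, of "Suc j"]) (simp add: ge)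
  then have "r + d \<le> z g"
    by (intro weakstar_cluster_ge[OF zc, of 0]) simp
  moreover have "\<bar>z g - g y\<bar> < d / 2"
    by (rule near[OF \<open>norm g \<le> 1\<close>])
  ultimately show False
    using y[folded e_def] by linarith
qed

section \<open>L-embedded spaces\<close>

text \<open>The functional \<open>v \<mapsto> f (P v) + (v - P v) g\<close> has norm at most \<open>1\<close> on the bidual because
  the norm is the sum of the norms of the two components.\<close>
lemma L_projection_functional:
  fixes P :: "'a::real_normed_vector bidual \<Rightarrow> 'a bidual" and f g :: "'a \<Rightarrow>\<^sub>L real"
  assumes P: "linear P" "P ` UNIV = range canon" "\<And>v. v \<in> range canon \<Longrightarrow> P v = v"
    "\<And>v. norm v = norm (P v) + norm (v - P v)"
    and "norm f \<le> 1" "norm g \<le> 1" "finite Z" "e > 0"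
  obtains h :: "'a \<Rightarrow>\<^sub>L real"
  where "norm h \<le> 1" "\<And>u. u \<in> Z \<Longrightarrow> \<bar>f u - h u\<bar> < e" "\<bar>(z - P z) g - (z - P z) h\<bar> < e"
proof -
  define \<phi> where "\<phi> v = P v f + (v - P v) g" for v
  have "linear \<phi>"
    unfolding \<phi>_def
    by (rule linearI)
      (simp_all add: linear_add[OF P(1)] linear_cmul[OF P(1)] blinfun.add_left blinfun.diff_left
        blinfun.scaleR_left algebra_simps)
  moreover have "\<phi> v \<le> norm v" for v
    using blinfun_apply_le_norm[OF assms(5), of "P v"] blinfun_apply_le_norm[OF assms(6), of "v - P v"] P(4)[of v]
    unfolding \<phi>_def by linarith
  ultimately obtain h where h: "norm h \<le> 1"
    "\<And>v. v \<in> insert (z - P z) (canon ` Z) \<Longrightarrow> \<bar>\<phi> v - v h\<bar> < e"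
    using goldstine[of \<phi> "insert (z - P z) (canon ` Z)" e] assms(7,8) by blast
  have "\<phi> (canon u) = f u" for u
    using P(3)[of "canon u"] by (simp add: \<phi>_def blinfun.zero_left)
  moreover have "P (P z) = P z"
    using P(2,3) by blast
  then have "\<phi> (z - P z) = (z - P z) g"
    by (simp add: \<phi>_def linear_diff[OF P(1)] blinfun.zero_left)
  ultimately show ?thesis
    using h that by (metis image_eqI insertCI blinfun_apply_canon)
qed

text \<open>Functionals are corrected in stages, with \<open>U\<close> recording vectors where the
  value exceeds \<open>d\<close>. Stage \<open>n\<close> adds \<open>x k - y\<close> and
  \<open>- (x k' - y)\<close> for some \<open>k\<close> and \<open>k'\<close> beyond
  \<open>n\<close>; a weak* cluster point of the functionals keeps all bounds in non-strict
  form.\<close>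

lemma L_embedded_oscillation:
  fixes x :: "nat \<Rightarrow> 'a::real_normed_vector"
  assumes P: "linear P" "P ` UNIV = range (canon :: 'a \<Rightarrow> 'a bidual)"
    "\<And>v. v \<in> range canon \<Longrightarrow> P v = v" "\<And>v. norm v = norm (P v) + norm (v - P v)"
    and z: "z \<in> clust x" and y: "P z = canon y"
    and d: "0 \<le> d" "d < norm (z - P z)"
  obtains f :: "'a \<Rightarrow>\<^sub>L real"
  where "norm f \<le> 1" "infinite {k. d \<le> f (x k - y)}" "infinite {k. f (x k - y) \<le> - d}"
proof -
  obtain g where g: "norm g \<le> 1" "d < (z - P z) g"
    using norm_blinfun_less_witness[OF d] by blast
  have extend: "\<exists>h k. norm h \<le> 1 \<and> n \<le> k \<and> d < blinfun_apply h (\<sigma> *\<^sub>R (x k - y)) \<and> (\<forall>u\<in>U. d < h u)"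
    if f: "norm f \<le> 1" and U: "finite U" "\<forall>u\<in>U. d < f u" and \<sigma>: "\<sigma> = 1 \<or> \<sigma> = - 1"
    for f :: "'a \<Rightarrow>\<^sub>L real" and U n and \<sigma> :: real
  proof -
    \<comment> \<open>The least slack in the strict inequalities reached so far: an error below
      \<open>e\<close> preserves all of them.\<close>
    define e where "e = Min (insert ((z - P z) g - d) ((\<lambda>u. f u - d) ` U))"
    have "e > 0"
      using g U by (simp add: e_def)
    have e: "e \<le> (z - P z) g - d" "\<And>u. u \<in> U \<Longrightarrow> e \<le> f u - d"
      unfolding e_def using U by auto
    have "norm (\<sigma> *\<^sub>R g) \<le> 1"
      using g(1) \<sigma> by auto
    then obtain h :: "'a \<Rightarrow>\<^sub>L real" where h: "norm h \<le> 1" "\<And>u. u \<in> U \<Longrightarrow> \<bar>f u - h u\<bar> < e"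
      "\<bar>(z - P z) (\<sigma> *\<^sub>R g) - (z - P z) h\<bar> < e"
      using L_projection_functional[OF P f _ U(1) \<open>e > 0\<close>] by blast
    have zh: "d < \<sigma> * (z - P z) h"
      using h(3) e(1) \<sigma> by (auto simp: blinfun.scaleR_right blinfun.minus_right)
    \<comment> \<open>Since \<open>(z - P z) h = z h - h y\<close>, an index where
      \<open>h (x k)\<close> is close to \<open>z h\<close> gives the bound at
      \<open>x k - y\<close>.\<close>
    then obtain k where k: "k \<ge> n" "\<bar>z h - h (x k)\<bar> < \<sigma> * (z - P z) h - d"
      using clustD[OF z, of "\<sigma> * (z - P z) h - d" n h] by auto
    have "d < h (\<sigma> *\<^sub>R (x k - y))"
      using k(2) \<sigma> zh y by (auto simp: blinfun.diff_left blinfun.diff_right blinfun.minus_right)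
    moreover have "d < h u" if "u \<in> U" for u
      using h(2)[OF that] e(2)[OF that] by linarith
    ultimately show ?thesis
      using h(1) k(1) by blast
  qed
  define Q where "Q = (\<lambda>(U :: 'a set, f). finite U \<and> norm f \<le> 1 \<and> (\<forall>u\<in>U. d < blinfun_apply f u))"
  have "\<exists>s. \<forall>n::nat. Q (s n) \<and> (fst (s n) \<subseteq> fst (s (Suc n)) \<and>
      (\<exists>k\<ge>n. x k - y \<in> fst (s (Suc n))) \<and> (\<exists>k\<ge>n. - (x k - y) \<in> fst (s (Suc n))))"
  proof (rule dependent_nat_choice)
    show "\<exists>s. Q s"
      by (rule exI[of _ "({}, 0)"]) (simp add: Q_def)
  next
    fix s :: "'a set \<times> ('a \<Rightarrow>\<^sub>L real)" and n :: nat
    assume "Q s"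
    obtain U f where s: "s = (U, f)" by force
    with \<open>Q s\<close> have U: "finite U" "norm f \<le> 1" "\<forall>u\<in>U. d < f u"
      by (auto simp: Q_def)
    obtain h :: "'a \<Rightarrow>\<^sub>L real" and k where h: "norm h \<le> 1" "n \<le> k" "d < h (x k - y)" "\<forall>u\<in>U. d < h u"
      using extend[OF U(2,1,3), of 1 n] by auto
    obtain h' :: "'a \<Rightarrow>\<^sub>L real" and k' where h': "norm h' \<le> 1" "n \<le> k'" "d < h' (- (x k' - y))" "\<forall>u\<in>insert (x k - y) U. d < h' u"
      using extend[OF h(1), of "insert (x k - y) U" "- 1" n] U(1) h(3,4) by auto
    show "\<exists>t. Q t \<and> fst s \<subseteq> fst t \<and> (\<exists>k\<ge>n. x k - y \<in> fst t) \<and> (\<exists>k\<ge>n. - (x k - y) \<in> fst t)"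
      by (rule exI[of _ "(insert (- (x k' - y)) (insert (x k - y) U), h')"])
        (use h h' U s in \<open>auto simp: Q_def\<close>)
  qed
  then obtain s where sQ: "\<And>n::nat. Q (s n)" and s_sub: "\<And>n. fst (s n) \<subseteq> fst (s (Suc n))"
    and s_pos: "\<And>n. \<exists>k\<ge>n. x k - y \<in> fst (s (Suc n))"
    and s_neg: "\<And>n. \<exists>k\<ge>n. - (x k - y) \<in> fst (s (Suc n))"
    by blast
  define U where "U n = fst (s n)" for n
  define f where "f n = snd (s n)" for n
  have f: "norm (f n) \<le> 1" "u \<in> U n \<Longrightarrow> d < f n u" for n u
    using sQ[of n] by (auto simp: Q_def U_def f_def split: prod.splits)
  have U_mono: "U n \<subseteq> U m" if "n \<le> m" for n m
    using s_sub that unfolding U_def by (rule lift_Suc_mono_le)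
  obtain g' where g': "weakstar_cluster f g'"
    using weakstar_cluster_exists[of f 1, OF f(1)] by blast
  have ge: "d \<le> g' u" if "u \<in> U n" for u n
  proof (rule weakstar_cluster_ge[OF g', of n])
    fix k assume "n \<le> k"
    then have "u \<in> U k"
      using U_mono that by blast
    then show "d \<le> f k u"
      using f(2)[of u k] by simp
  qed
  show ?thesis
  proof
    show "norm g' \<le> 1"
      by (rule norm_weakstar_cluster_le[OF g' f(1)])
    show "infinite {k. d \<le> g' (x k - y)}"
      unfolding infinite_nat_iff_unbounded_le
    proof
      fix m
      obtain k where "k \<ge> m" "x k - y \<in> U (Suc m)"
        using s_pos[of m] by (auto simp: U_def)
      with ge show "\<exists>n\<ge>m. n \<in> {k. d \<le> g' (x k - y)}" by blast
    qed
    show "infinite {k. g' (x k - y) \<le> - d}"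
      unfolding infinite_nat_iff_unbounded_le
    proof
      fix m
      obtain k where "k \<ge> m" "- (x k - y) \<in> U (Suc m)"
        using s_neg[of m] by (auto simp: U_def)
      with ge have "d \<le> g' (- (x k - y))" by blast
      then have "g' (x k - y) \<le> - d"
        by (simp only: blinfun.minus_right)
      with \<open>k \<ge> m\<close> show "\<exists>n\<ge>m. n \<in> {k. g' (x k - y) \<le> - d}" by blast
    qed
  qed
qed

text \<open>\<open>P z\<close> belongs to the space, so the distance is at most
  \<open>norm (z - P z)\<close>. For each smaller \<open>d \<ge> 0\<close> a functional swings
  between \<open>d\<close> and \<open>- d\<close> along \<open>x k - y\<close>, which gives
  \<open>2 * d \<le> delta_X x\<close>.\<close>

lemma L_embedded_infdist_le:
  fixes x :: "nat \<Rightarrow> 'a::real_normed_vector"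
  assumes "L_embedded TYPE('a)" and bd: "bounded (range x)" and z: "z \<in> clust x"
  shows "2 * infdist z (range canon) \<le> delta_X x"
proof -
  obtain P :: "'a bidual \<Rightarrow> 'a bidual" where P: "linear P" "P ` UNIV = range canon"
    "\<And>v. v \<in> range canon \<Longrightarrow> P v = v" "\<And>v. norm v = norm (P v) + norm (v - P v)"
    using assms(1) unfolding L_embedded_def by blast
  obtain y where y: "P z = canon y"
    using P(2) by blast
  have "infdist z (range canon) \<le> norm (z - P z)"
    using infdist_le[of "canon y" "range canon" z] by (simp add: y dist_norm)
  moreover have "norm (z - P z) \<le> delta_X x / 2"
  proof (rule dense_le)
    fix d assume "d < norm (z - P z)"
    show "d \<le> delta_X x / 2"
    proof (cases "0 \<le> d")
      case True
      obtain f :: "'a \<Rightarrow>\<^sub>L real"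
        where f: "norm f \<le> 1" "infinite {k. d \<le> f (x k - y)}" "infinite {k. f (x k - y) \<le> - d}"
        using L_embedded_oscillation[OF P z y True \<open>d < norm (z - P z)\<close>] by blast
      \<comment> \<open>The shift by \<open>f y\<close> moves both levels equally and cancels in
        their difference.\<close>
      have "{k. d \<le> f (x k - y)} = {k. d + f y \<le> f (x k)}" "{k. f (x k - y) \<le> - d} = {k. f (x k) \<le> f y - d}"
        by (auto simp: blinfun.diff_right)
      with f have "(d + f y) - (f y - d) \<le> delta_X x"
        by (intro delta_X_ge[OF bd f(1)]) auto
      then show ?thesis by simp
    next
      case False
      then show ?thesis
        using delta_X_nonneg[OF bd] by linarith
    qed
  qed
  ultimately show ?thesis by simp
qed

lemma L_embedded_dhat_le:
  fixes x :: "nat \<Rightarrow> 'a::real_normed_vector"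
  assumes "L_embedded TYPE('a)" and bd: "bounded (range x)"
  shows "2 * set_dhat (clust x) (range canon) \<le> delta_X x"
proof -
  have "set_dhat (clust x) (range canon) \<le> delta_X x / 2"
    unfolding set_dhat_def
    using L_embedded_infdist_le[OF assms(1) bd] by (intro cSUP_least clust_nonempty[OF bd]) force
  then show ?thesis by simp
qed

text \<open>A cluster point of a subsequence is also one of \<open>x\<close>, and
  \<open>L_embedded_infdist_le\<close> for that subsequence bounds its distance by half of the
  subsequence's diameter.\<close>

lemma L_embedded_dist_le:
  fixes x :: "nat \<Rightarrow> 'a::real_normed_vector"
  assumes "L_embedded TYPE('a)" and bd: "bounded (range x)"
  shows "2 * set_dist (clust x) (range canon) \<le> delta_tilde x"
  unfolding delta_tilde_def
proof (rule cINF_greatest)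
  show "{r :: nat \<Rightarrow> nat. strict_mono r} \<noteq> {}"
    using strict_mono_id by blast
  fix r :: "nat \<Rightarrow> nat" assume "r \<in> {r. strict_mono r}"
  have bd': "bounded (range (x \<circ> r))"
    by (rule bounded_range_comp[OF bd])
  obtain z where z: "z \<in> clust (x \<circ> r)"
    using clust_nonempty[OF bd'] by blast
  have "set_dist (clust x) (range canon) \<le> infdist z (range canon)"
    unfolding set_dist_def using z clust_subseq \<open>r \<in> _\<close>
    by (intro cINF_lower bdd_belowI2[of _ 0]) (auto intro: infdist_nonneg)
  also have "2 * \<dots> \<le> delta_X (x \<circ> r)"
    by (rule L_embedded_infdist_le[OF assms(1) bd' z])
  finally show "2 * set_dist (clust x) (range canon) \<le> delta_X (x \<circ> r)"
    by simp
qed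

theorem theorem1p1:
  fixes x :: "nat \<Rightarrow> 'a::banach"
  assumes "bounded (range x)"
  shows "delta_tilde x \<le> 2 * set_dhat (clust x) (range (canon :: 'a \<Rightarrow> 'a bidual)) \<and>
         (L_embedded TYPE('a) \<longrightarrow>
           2 * set_dhat (clust x) (range (canon :: 'a \<Rightarrow> 'a bidual)) \<le> delta_X x \<and>
           2 * set_dist (clust x) (range (canon :: 'a \<Rightarrow> 'a bidual)) \<le> delta_tilde x)"
  using delta_tilde_le_dhat[OF assms] L_embedded_dhat_le[OF _ assms] L_embedded_dist_le[OF _ assms]
  by blast

end
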